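(* Let $\sigma\subseteq\tau$ be topologies on a set $X$. Assume that $\tau$ is regular, Baire, and has a neighborhood basis consisting of sets that have the Baire property with respect to $\sigma$. If $\sigma=(\sigma,\tau)$, then $\sigma=\tau$.
   Context: A topology is Baire if every countable union of nowhere dense sets has dense complement. A neighborhood of $x$ (w.r.t. $\tau$) is any set containing $x$ in its $\tau$-interior; a neighborhood basis of $\tau$ is a family $\mathcal A$ of subsets of $X$ such that for each $x\in X$ and each neighborhood $B$ of $x$ there is $A\in\mathcal A$ which is a neighborhood of $x$ with $A\subseteq B$ (sets in $\mathcal A$ need not be open). $(\sigma,\tau)$ denotes the topology consisting of all unions of sets $U\cap{\rm int}_\tau(F)$ with $U$ $\sigma$-open and $F$ $\sigma$-closed. *)

theory Defs
  imports "HOL-Analysis.Analysis"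
begin

definition nowhere_dense_in :: "'a topology \<Rightarrow> 'a set \<Rightarrow> bool" where
  "nowhere_dense_in X N \<longleftrightarrow>
     N \<subseteq> topspace X \<and> X interior_of (X closure_of N) = {}"

definition meager_in :: "'a topology \<Rightarrow> 'a set \<Rightarrow> bool" where
  "meager_in X = countable union_of nowhere_dense_in X"

definition baire_topology :: "'a topology \<Rightarrow> bool" where
  "baire_topology X \<longleftrightarrow>
     (\<forall>M. meager_in X M \<longrightarrow> X closure_of (topspace X - M) = topspace X)"

definition baire_property_in :: "'a topology \<Rightarrow> 'a set \<Rightarrow> bool" where
  "baire_property_in X A \<longleftrightarrow> (\<exists>U. openin X U \<and> meager_in X (sym_diff A U))"

(* The library's neighbourhood_base_of ranges over open W only; the two lemmas below show
   that this agrees with the formulation over arbitrary neighbourhoods B, and that sets with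
   the Baire property lie in the underlying set. *)
lemma neighbourhood_base_of_iff_neighbourhoods:
  "neighbourhood_base_of (\<lambda>A. A \<in> \<A>) X \<longleftrightarrow>
     (\<forall>x \<in> topspace X. \<forall>B. x \<in> X interior_of B \<longrightarrow>
        (\<exists>A \<in> \<A>. x \<in> X interior_of A \<and> A \<subseteq> B))"
  (is "?L \<longleftrightarrow> ?R")
proof
  assume L: ?L
  show ?R
  proof (intro ballI allI impI)
    fix x B assume "x \<in> X interior_of B"
    then obtain U V where "openin X U" "V \<in> \<A>" "x \<in> U" "U \<subseteq> V" "V \<subseteq> X interior_of B"
      using L unfolding neighbourhood_base_of by (metis openin_interior_of)
    then show "\<exists>A \<in> \<A>. x \<in> X interior_of A \<and> A \<subseteq> B"
      by (meson interior_of_maximal interior_of_subset subset_trans subsetD)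
  qed
next
  assume R: ?R
  show ?L
    unfolding neighbourhood_base_of
  proof (intro allI impI, elim conjE)
    fix W x assume "openin X W" "x \<in> W"
    then have "x \<in> topspace X" "x \<in> X interior_of W"
      using openin_subset by (auto simp: interior_of_openin)
    with R obtain A where "A \<in> \<A>" "x \<in> X interior_of A" "A \<subseteq> W"
      by blast
    then show "\<exists>U V. openin X U \<and> V \<in> \<A> \<and> x \<in> U \<and> U \<subseteq> V \<and> V \<subseteq> W"
      by (meson interior_of_subset openin_interior_of)
  qed
qed

lemma baire_property_in_subset:
  assumes "baire_property_in X A"
  shows "A \<subseteq> topspace X"
proof -
  obtain U where U: "openin X U" "meager_in X (sym_diff A U)"
    using assms unfolding baire_property_in_def by blast
  then have "sym_diff A U \<subseteq> topspace X"
    unfolding meager_in_def union_of_def nowhere_dense_in_def by blast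
  then show ?thesis
    using openin_subset[OF U(1)] by blast
qed

definition pair_topology :: "'a topology \<Rightarrow> 'a topology \<Rightarrow> 'a topology" where
  "pair_topology \<sigma> \<tau> =
     topology (arbitrary union_of (\<lambda>S. \<exists>U F. openin \<sigma> U \<and> closedin \<sigma> F \<and> S = U \<inter> \<tau> interior_of F))"

(* The function topology is only meaningful on families that are topologies, which this one is. *)
lemma openin_pair_topology:
  "openin (pair_topology \<sigma> \<tau>) =
     arbitrary union_of (\<lambda>S. \<exists>U F. openin \<sigma> U \<and> closedin \<sigma> F \<and> S = U \<inter> \<tau> interior_of F)"
proof -
  have "istopology (arbitrary union_of
     (\<lambda>S. \<exists>U F. openin \<sigma> U \<and> closedin \<sigma> F \<and> S = U \<inter> \<tau> interior_of F))"
  proof (rule istopology_base, elim exE conjE)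
    fix S T U F V G
    assume "openin \<sigma> U" "closedin \<sigma> F" "S = U \<inter> \<tau> interior_of F"
      and "openin \<sigma> V" "closedin \<sigma> G" "T = V \<inter> \<tau> interior_of G"
    then have "openin \<sigma> (U \<inter> V)" "closedin \<sigma> (F \<inter> G)"
      "S \<inter> T = (U \<inter> V) \<inter> \<tau> interior_of (F \<inter> G)"
      by (auto simp: interior_of_Int)
    then show "\<exists>U F. openin \<sigma> U \<and> closedin \<sigma> F \<and> S \<inter> T = U \<inter> \<tau> interior_of F"
      by blast
  qed
  then show ?thesis
    unfolding pair_topology_def by (rule topology_inverse')
qed

end

theory Submission
  imports Defs
begin

text \<open>
  The hypothesis \<open>\<sigma> = (\<sigma>, \<tau>)\<close> makes the \<open>\<tau>\<close>-interior of every \<open>\<sigma>\<close>-closed set \<open>\<sigma>\<close>-open. Hence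
  \<open>\<sigma>\<close>-meager sets are \<open>\<tau>\<close>-meager, and both topologies assign the same closure to a \<open>\<sigma>\<close>-open set.
  Given a \<open>\<tau>\<close>-open \<open>W\<close> containing \<open>x\<close>, choose by regularity a \<open>\<tau>\<close>-closed neighborhood \<open>C \<subseteq> W\<close>
  of \<open>x\<close> and then a neighborhood \<open>A \<subseteq> C\<close> of \<open>x\<close> that differs from a \<open>\<sigma>\<close>-open set \<open>U\<close> by a
  \<open>\<sigma>\<close>-meager set. As no nonempty \<open>\<tau>\<close>-open set is \<open>\<tau>\<close>-meager, \<open>int\<^sub>\<tau> A\<close> lies in the closure \<open>F\<close> of
  \<open>U\<close>, and \<open>U\<close>, hence \<open>F\<close>, lies in \<open>C\<close>. So \<open>int\<^sub>\<tau> F\<close> is a \<open>\<sigma>\<close>-open set with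
  \<open>x \<in> int\<^sub>\<tau> F \<subseteq> W\<close>.
\<close>

lemma nowhere_dense_in_subset:
  assumes "nowhere_dense_in X N" "S \<subseteq> N"
  shows "nowhere_dense_in X S"
  using assms interior_of_mono[OF closure_of_mono[OF \<open>S \<subseteq> N\<close>], of X X]
  unfolding nowhere_dense_in_def by blast

lemma meager_in_subset:
  assumes "meager_in X M" "S \<subseteq> M"
  shows "meager_in X S"
proof -
  obtain \<N> where "countable \<N>" "\<N> \<subseteq> Collect (nowhere_dense_in X)" "\<Union>\<N> = M"
    using assms(1) unfolding meager_in_def union_of_def by blast
  then have "countable ((\<inter>) S ` \<N>)" "(\<inter>) S ` \<N> \<subseteq> Collect (nowhere_dense_in X)"
    "\<Union>((\<inter>) S ` \<N>) = S"
    using assms(2) by (auto intro: nowhere_dense_in_subset)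
  then show ?thesis
    unfolding meager_in_def union_of_def by blast
qed

lemma meager_in_mono:
  assumes "meager_in X M" "\<And>N. nowhere_dense_in X N \<Longrightarrow> nowhere_dense_in Y N"
  shows "meager_in Y M"
  using assms unfolding meager_in_def union_of_def by blast

lemma baire_topology_openin_meager_empty:
  assumes "baire_topology X" "openin X W" "meager_in X W"
  shows "W = {}"
proof -
  have "X closure_of (topspace X - W) = topspace X"
    using assms unfolding baire_topology_def by blast
  moreover have "X closure_of (topspace X - W) = topspace X - W"
    using assms(2) by (simp add: closure_of_closedin closedin_diff)
  ultimately show ?thesis
    using openin_subset[OF assms(2)] by blast
qed

lemma openin_pair_topology_interior_of:
  assumes "closedin \<sigma> F" "topspace \<tau> = topspace \<sigma>"
  shows "openin (pair_topology \<sigma> \<tau>) (\<tau> interior_of F)"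
proof -
  have "\<tau> interior_of F = topspace \<sigma> \<inter> \<tau> interior_of F"
    using assms(2) interior_of_subset_topspace[of \<tau> F] by auto
  then show ?thesis
    using assms(1) unfolding openin_pair_topology
    by (intro arbitrary_union_of_inc) blast
qed

text \<open>By \<open>int\<close>, the \<tau>-interior of the \<sigma>-closure of \<open>N\<close>
  is \<sigma>-open, so it lies in the \<sigma>-interior, which is empty.\<close>

lemma nowhere_dense_in_finer:
  assumes top: "topspace \<tau> = topspace \<sigma>"
    and fin: "\<And>U. openin \<sigma> U \<Longrightarrow> openin \<tau> U"
    and int: "\<And>F. closedin \<sigma> F \<Longrightarrow> openin \<sigma> (\<tau> interior_of F)"
    and N: "nowhere_dense_in \<sigma> N"
  shows "nowhere_dense_in \<tau> N"
proof -
  have "closedin \<tau> (\<sigma> closure_of N)"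
    using fin top closedin_closure_of[of \<sigma> N] unfolding closedin_def by auto
  moreover have "N \<subseteq> \<sigma> closure_of N"
    using N by (simp add: nowhere_dense_in_def closure_of_subset)
  ultimately have "\<tau> interior_of (\<tau> closure_of N) \<subseteq> \<tau> interior_of (\<sigma> closure_of N)"
    by (intro interior_of_mono closure_of_minimal)
  also have "\<dots> \<subseteq> \<sigma> interior_of (\<sigma> closure_of N)"
    by (intro interior_of_maximal interior_of_subset int closedin_closure_of)
  finally show ?thesis
    using N top by (auto simp: nowhere_dense_in_def)
qed

text \<open>The complement of \<open>\<tau> closure_of U\<close> is the \<tau>-interior of a
  \<sigma>-closed set, hence \<sigma>-open by \<open>int\<close>.\<close>

lemma closure_of_openin_finer:
  assumes top: "topspace \<tau> = topspace \<sigma>"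
    and fin: "\<And>U. openin \<sigma> U \<Longrightarrow> openin \<tau> U"
    and int: "\<And>F. closedin \<sigma> F \<Longrightarrow> openin \<sigma> (\<tau> interior_of F)"
    and U: "openin \<sigma> U"
  shows "\<tau> closure_of U = \<sigma> closure_of U"
proof
  have "closedin \<tau> (\<sigma> closure_of U)"
    using fin top closedin_closure_of[of \<sigma> U] unfolding closedin_def by auto
  then show "\<tau> closure_of U \<subseteq> \<sigma> closure_of U"
    using U by (simp add: closure_of_minimal closure_of_subset openin_subset)
  have "\<tau> closure_of U = topspace \<sigma> - \<tau> interior_of (topspace \<sigma> - U)"
    using top by (simp add: closure_of_interior_of)
  then have "closedin \<sigma> (\<tau> closure_of U)"
    using int[of "topspace \<sigma> - U"] U by auto
  then show "\<sigma> closure_of U \<subseteq> \<tau> closure_of U"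
    using U top by (simp add: closure_of_minimal closure_of_subset openin_subset)
qed

theorem theorem3p1:
  fixes X :: "'a set" and \<sigma> \<tau> :: "'a topology"
  assumes "topspace \<sigma> = X" and "topspace \<tau> = X"
    and "\<forall>U. openin \<sigma> U \<longrightarrow> openin \<tau> U"
    and "regular_space \<tau>"
    and "baire_topology \<tau>"
    and "\<exists>\<A>. neighbourhood_base_of (\<lambda>A. A \<in> \<A>) \<tau> \<and> (\<forall>A \<in> \<A>. baire_property_in \<sigma> A)"
    and "\<sigma> = pair_topology \<sigma> \<tau>"
  shows "\<sigma> = \<tau>"
proof -
  have top: "topspace \<tau> = topspace \<sigma>"
    using assms(1,2) by simp
  have fin: "openin \<tau> U" if "openin \<sigma> U" for U
    using assms(3) that by blast
  have int: "openin \<sigma> (\<tau> interior_of F)" if "closedin \<sigma> F" for F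
    using openin_pair_topology_interior_of[OF that top] unfolding assms(7)[symmetric] .
  have closed_base: "neighbourhood_base_of (closedin \<tau>) \<tau>"
    using assms(4) by (simp add: neighbourhood_base_of_closedin)
  obtain \<A> where \<A>: "neighbourhood_base_of (\<lambda>A. A \<in> \<A>) \<tau>" "\<And>A. A \<in> \<A> \<Longrightarrow> baire_property_in \<sigma> A"
    using assms(6) by blast
  have "openin \<sigma> W" if W: "openin \<tau> W" for W
  proof (subst openin_subopen, intro ballI)
    fix x assume "x \<in> W"
    then obtain V C where V: "openin \<tau> V" "closedin \<tau> C" "x \<in> V" "V \<subseteq> C" "C \<subseteq> W"
      using W closed_base unfolding neighbourhood_base_of by meson
    then obtain O' A where A: "openin \<tau> O'" "A \<in> \<A>" "x \<in> O'" "O' \<subseteq> A" "A \<subseteq> V"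
      using \<A>(1) unfolding neighbourhood_base_of by meson
    then obtain U where U: "openin \<sigma> U" "meager_in \<sigma> (sym_diff A U)"
      using \<A>(2) unfolding baire_property_in_def by blast
    define F where "F = \<sigma> closure_of U"
    have F: "closedin \<sigma> F" "F = \<tau> closure_of U"
      unfolding F_def using closure_of_openin_finer[OF top fin int U(1)] by auto
    have empty: "S = {}" if "openin \<tau> S" "S \<subseteq> sym_diff A U" for S
      using baire_topology_openin_meager_empty[OF assms(5) that(1)] that(2)
        meager_in_subset[OF meager_in_mono[OF U(2) nowhere_dense_in_finer[OF top fin int]]]
      by blast
    have "U \<subseteq> F"
      unfolding F_def by (simp add: U(1) closure_of_subset openin_subset)
    \<comment> \<open>This set is \<tau>-open and contained in \<open>A - U\<close>.\<close>
    then have "O' - F = {}"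
      using A F by (intro empty) auto
    then have "x \<in> \<tau> interior_of F"
      using A(1,3) by (auto simp: interior_of_def)
    \<comment> \<open>Likewise \<tau>-open, and inside \<open>U - A\<close> because
      \<open>A \<subseteq> V \<subseteq> C\<close>.\<close>
    moreover have "U - C = {}"
      using A V U(1) by (intro empty) (auto intro: fin)
    \<comment> \<open>\<open>C\<close> is only known to be \<tau>-closed, so \<open>F\<close> is
      taken here as the \<tau>-closure of \<open>U\<close>.\<close>
    then have "F \<subseteq> W"
      using V(2,5) closure_of_minimal[of U C \<tau>] unfolding F(2) by blast
    ultimately show "\<exists>T. openin \<sigma> T \<and> x \<in> T \<and> T \<subseteq> W"
      using int[OF F(1)] interior_of_subset[of \<tau> F] by blast
  qed
  then show ?thesis
    using fin by (auto simp: topology_eq)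
qed

end
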